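(* Let $f$ be a continuous regular function on $\mathbb T$ for which there exist two reals $\rho_1<1<\rho_2$ such that $f$ is the restriction to $\mathbb T$ (identified with the unit circle) of a continuous, strictly positive function on $\{z\in\mathbb C : \rho_1<|z|<\rho_2\}$. If $|k-l|$ tends to infinity with $N$, then for every $\rho\in]1,\rho_2[$, $$\left(T_N(f)\right)^{-1}_{k,l}=O\left(\left(\frac1\rho\right)^{|l-k|}\right).$$
   Context: $\mathbb T=\mathbb R/2\pi\mathbb Z$, identified with the unit circle via $\theta\mapsto e^{i\theta}$. A regular function is a function in $L^1(\mathbb T)$ that is strictly positive on $\mathbb T$. $T_N(f)$ denotes the $(N+1)\times(N+1)$ Toeplitz matrix with entries $(T_N(f))_{k+1,l+1}=\hat f(k-l)$, $0\le k,l\le N$, where $\hat f(j)$ is the Fourier coefficient of order $j$ of $f$. $(T_N(f))^{-1}_{k,l}$ is the $(k,l)$ entry of the inverse matrix; here $k=k_N$ and $l=l_N$ are indices depending on $N$, and the $O$ is as $N\to+\infty$.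
   Formalization: The extension of f to the annulus is assumed holomorphic and zero-free instead of continuous and strictly positive; the latter holds for every continuous positive f via f(z/|z|), and the claim then fails for f(z)=|1-az|², 0<a<1, ρ>1/a. *)

theory Defs
  imports
    "HOL-Analysis.Analysis"
    "HOL-Library.Landau_Symbols"
    "Jordan_Normal_Form.Gauss_Jordan_Elimination"
begin

(* The torus is the unit circle "sphere (0::complex) 1"; only the values of f there matter. *)

definition regular_function :: "(complex \<Rightarrow> real) \<Rightarrow> bool" where
  "regular_function f \<longleftrightarrow>
     set_integrable lborel {0..2 * pi} (\<lambda>t. f (cis t)) \<and> (\<forall>z\<in>sphere 0 1. 0 < f z)"

definition fourier_coeff :: "(complex \<Rightarrow> real) \<Rightarrow> int \<Rightarrow> complex" where
  "fourier_coeff f j =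
     (LINT t:{0..2 * pi}|lborel. of_real (f (cis t)) * cis (- (of_int j * t))) / of_real (2 * pi)"

definition toeplitz :: "nat \<Rightarrow> (complex \<Rightarrow> real) \<Rightarrow> complex mat" where
  "toeplitz N f = Matrix.mat (N + 1) (N + 1) (\<lambda>(k, l). fourier_coeff f (int k - int l))"

(* Rows and columns are numbered 1, ..., N + 1, whereas the type mat counts from 0. *)
definition toeplitz_inv_entry :: "nat \<Rightarrow> (complex \<Rightarrow> real) \<Rightarrow> nat \<Rightarrow> nat \<Rightarrow> complex" where
  "toeplitz_inv_entry N f k l = the (mat_inverse (toeplitz N f)) $$ (k - 1, l - 1)"

definition annulus :: "real \<Rightarrow> real \<Rightarrow> complex set" where
  "annulus r1 r2 = {z. r1 < cmod z \<and> cmod z < r2}"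

(* The source asks for a "continuous, strictly positive" function on the annulus.
   Taken literally this restricts nothing: z \<mapsto> f (z / |z|) extends every continuous
   positive f, and the decay estimate is false at that generality (a tridiagonal example is
   f z = |1 - a z|^2 with 0 < a < 1). For an analytic extension, strict positivity
   off the circle would force F to be constant, so it becomes the absence of zeros. *)
definition extends_to_annulus :: "(complex \<Rightarrow> real) \<Rightarrow> real \<Rightarrow> real \<Rightarrow> bool" where
  "extends_to_annulus f r1 r2 \<longleftrightarrow>
     (\<exists>F. F holomorphic_on annulus r1 r2 \<and>
          (\<forall>z\<in>annulus r1 r2. F z \<noteq> 0) \<and>
          (\<forall>z\<in>sphere 0 1. F z = of_real (f z)))"

end

theory Submission
  imports Defs "HOL-Complex_Analysis.Complex_Analysis" "Jordan_Normal_Form.Determinant"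
begin

text \<open>
  Since \<open>f > 0\<close> on the circle, \<open>F \<circ> exp\<close> has a \<open>2\<pi>\<i>\<close>-periodic holomorphic logarithm on a strip around the
  imaginary axis. Moving the line of integration shows that the Fourier coefficients of \<open>ln f\<close> are
  \<open>O(R\<^sup>-\<^sup>|\<^sup>n\<^sup>|)\<close> for every \<open>R < \<rho>2\<close>; their nonnegative half gives \<open>A\<close>, holomorphic on \<open>|z| < R\<close>, with
  \<open>f = |exp A|\<^sup>2\<close> on the circle.

  A column \<open>v\<close> of the inverse, of index \<open>l\<close>, is a polynomial \<open>p\<close> of degree \<open>\<le> N\<close> such that \<open>f p\<close> has Fourier
  coefficient \<open>\<delta>\<^sub>n\<^sub>l\<close> for \<open>0 \<le> n \<le> N\<close>; its other coefficients are bounded independently of \<open>N\<close>.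
  Multiplying \<open>f p\<close> by the conjugate of \<open>exp (- A)\<close>, whose frequencies are nonpositive, and then by
  \<open>exp (- A)\<close> recovers \<open>p\<close> and yields \<open>v\<^sub>k = O(\<rho>\<^sup>-\<^sup>(\<^sup>l\<^sup>-\<^sup>k\<^sup>))\<close> for \<open>k \<le> l\<close>, because the unknown coefficients of \<open>f p\<close>
  beyond \<open>N \<ge> l\<close> enter only with weight \<open>\<rho>\<^sup>-\<^sup>(\<^sup>N\<^sup>-\<^sup>k\<^sup>)\<close>. The case \<open>k > l\<close> follows by applying this to the
  conjugated rows, the Toeplitz matrix being Hermitian.
\<close>

section \<open>Fourier coefficients on the circle\<close>

text \<open>The gauge integral is used here instead of the set Lebesgue integral of
  \<open>fourier_coeff\<close>. The two are matched for continuous symbols in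
  \<open>fourier_coeff_eq_circ_coeff\<close>.\<close>

definition circ_mean :: "(complex \<Rightarrow> complex) \<Rightarrow> complex" where
  "circ_mean h = integral {0..2 * pi} (\<lambda>t. h (cis t)) / of_real (2 * pi)"

definition circ_coeff :: "(complex \<Rightarrow> complex) \<Rightarrow> int \<Rightarrow> complex" where
  "circ_coeff h n = circ_mean (\<lambda>z. h z * z powi (- n))"

lemma continuous_on_circ_param:
  fixes h :: "complex \<Rightarrow> 'a :: topological_space"
  assumes "continuous_on (sphere 0 1) h"
  shows "continuous_on S (\<lambda>t. h (cis t))"
proof -
  have "continuous_on S (h \<circ> cis)"
    by (intro continuous_on_compose continuous_on_subset[OF assms] continuous_on_cis
        continuous_on_id) auto
  then show ?thesis by (simp add: o_def)
qed

lemma circ_param_integrable: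
  fixes h :: "complex \<Rightarrow> complex"
  assumes "continuous_on (sphere 0 1) h"
  shows "(\<lambda>t. h (cis t)) integrable_on {0..2 * pi}"
  using continuous_on_circ_param[OF assms] by (intro integrable_continuous_interval) auto

lemma continuous_on_powi_circle [continuous_intros]:
  "continuous_on (sphere 0 1) (\<lambda>z::complex. z powi n)"
  by (intro continuous_intros) auto

lemma sphere_cisE:
  assumes "z \<in> sphere (0::complex) 1"
  obtains t where "t \<in> {0..2 * pi}" "z = cis t"
proof
  have z: "cmod z = 1" using assms by simp
  show "Arg2pi z \<in> {0..2 * pi}"
    using Arg2pi_ge_0[of z] Arg2pi_lt_2pi[of z] by auto
  show "z = cis (Arg2pi z)"
    using Arg2pi_eq[of z] z by (simp add: cis_conv_exp)
qed

lemma circ_mean_cong: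
  assumes "\<And>z. z \<in> sphere 0 1 \<Longrightarrow> g z = h z"
  shows "circ_mean g = circ_mean h"
  unfolding circ_mean_def by (intro arg_cong2[where f = "(/)"] integral_cong) (auto simp: assms)

lemma circ_mean_add:
  assumes "continuous_on (sphere 0 1) g" "continuous_on (sphere 0 1) h"
  shows "circ_mean (\<lambda>z. g z + h z) = circ_mean g + circ_mean h"
  unfolding circ_mean_def
  by (simp add: integral_add circ_param_integrable assms add_divide_distrib)

lemma circ_mean_mult_left: "circ_mean (\<lambda>z. c * h z) = c * circ_mean h"
  unfolding circ_mean_def by simp

lemma circ_mean_sum:
  assumes "finite I" "\<And>i. i \<in> I \<Longrightarrow> continuous_on (sphere 0 1) (h i)"
  shows "circ_mean (\<lambda>z. \<Sum>i\<in>I. h i z) = (\<Sum>i\<in>I. circ_mean (h i))"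
  unfolding circ_mean_def
  by (simp add: integral_sum circ_param_integrable assms sum_divide_distrib)

lemma circ_mean_cnj:
  "circ_mean (\<lambda>z. cnj (h z)) = cnj (circ_mean h)"
  unfolding circ_mean_def by (simp add: integral_cnj)

lemma circ_mean_of_real:
  assumes "continuous_on (sphere 0 1) g"
  shows "circ_mean (\<lambda>z. of_real (g z)) = of_real (integral {0..2 * pi} (\<lambda>t. g (cis t)) / (2 * pi))"
proof -
  have "(\<lambda>t. g (cis t)) integrable_on {0..2 * pi}"
    by (intro integrable_continuous_interval continuous_on_circ_param assms)
  then have "((\<lambda>t. of_real (g (cis t)) :: complex) has_integral 
      of_real (integral {0..2 * pi} (\<lambda>t. g (cis t)))) {0..2 * pi}"
    by (intro has_integral_of_real integrable_integral)
  then show ?thesis unfolding circ_mean_def by (simp add: integral_unique)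
qed

text \<open>The majorant is a function rather than a constant because the energy estimates below
  compare with \<open>f z * cmod (p z) ^ 2\<close>. \<open>Re\<close> only converts its mean, a
  complex number on the real axis, to a real.\<close>

lemma norm_circ_mean_le:
  assumes h: "continuous_on (sphere 0 1) h" and g: "continuous_on (sphere 0 1) g"
    and le: "\<And>z. z \<in> sphere 0 1 \<Longrightarrow> cmod (h z) \<le> g z"
  shows "cmod (circ_mean h) \<le> Re (circ_mean (\<lambda>z. of_real (g z)))"
proof -
  have "cmod (integral {0..2 * pi} (\<lambda>t. h (cis t))) \<le> integral {0..2 * pi} (\<lambda>t. g (cis t))"
    by (intro integral_norm_bound_integral circ_param_integrable h
        integrable_continuous_interval continuous_on_circ_param g le) auto
  then show ?thesis
    unfolding circ_mean_of_real[OF g] unfolding circ_mean_def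
    by (simp add: norm_divide divide_right_mono)
qed

lemma circ_mean_const: "circ_mean (\<lambda>z. c) = c"
  unfolding circ_mean_def by (simp add: scaleR_conv_of_real)

lemma norm_circ_mean_le_const:
  assumes "continuous_on (sphere 0 1) h" "\<And>z. z \<in> sphere 0 1 \<Longrightarrow> cmod (h z) \<le> B"
  shows "cmod (circ_mean h) \<le> B"
  using norm_circ_mean_le[OF assms(1) continuous_on_const assms(2)] by (simp add: circ_mean_const)

lemma circ_mean_powi: "circ_mean (\<lambda>z. z powi n) = (if n = 0 then 1 else 0)"
proof (cases "n = 0")
  case False
  let ?G = "\<lambda>t::real. exp (\<i> * of_int n * of_real t) / (\<i> * of_int n)"
  have "((\<lambda>t. exp (\<i> * of_int n * of_real t)) has_integral (?G (2 * pi) - ?G 0)) {0..2 * pi}"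
  proof (rule fundamental_theorem_of_calculus)
    fix t :: real
    have "((\<lambda>z. exp (\<i> * of_int n * z) / (\<i> * of_int n)) has_field_derivative
        exp (\<i> * of_int n * of_real t)) (at (of_real t))"
      by (rule derivative_eq_intros refl | use False in simp)+
    then show "(?G has_vector_derivative exp (\<i> * of_int n * of_real t)) (at t within {0..2 * pi})"
      by (rule has_vector_derivative_real_field)
  qed simp
  moreover have "exp (\<i> * of_int n * of_real (2 * pi)) = 1"
    using exp_integer_2pi[of "of_int n"] by (simp add: algebra_simps)
  ultimately have "((\<lambda>t. exp (\<i> * of_int n * of_real t)) has_integral 0) {0..2 * pi}"
    by simp
  moreover have "cis t powi n = exp (\<i> * of_int n * of_real t)" for t
    unfolding cis_power_int by (simp add: cis_conv_exp algebra_simps)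
  ultimately show ?thesis
    using False unfolding circ_mean_def by (simp add: integral_unique)
qed (simp add: circ_mean_const)

text \<open>The factor \<open>h\<close> is bounded on the compact circle by some \<open>B\<close>,
  so the terms have the summable majorant \<open>cmod (a i) * B\<close>. The Weierstrass test then
  permits termwise integration.\<close>

lemma circ_mean_series:
  assumes a: "summable (\<lambda>i. cmod (a i))"
    and \<phi>: "\<And>i. continuous_on (sphere 0 1) (\<phi> i)" "\<And>i z. z \<in> sphere 0 1 \<Longrightarrow> cmod (\<phi> i z) \<le> 1"
    and h: "continuous_on (sphere 0 1) h"
  shows "(\<lambda>i. a i * circ_mean (\<lambda>z. \<phi> i z * h z)) sums circ_mean (\<lambda>z. (\<Sum>i. a i * \<phi> i z) * h z)"
proof -
  have "compact (h ` sphere 0 1)" by (intro compact_continuous_image h) auto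
  then obtain B where B: "\<And>z. z \<in> sphere 0 1 \<Longrightarrow> cmod (h z) \<le> B"
    by (meson bounded_iff compact_imp_bounded imageI)
  define S where "S = (\<lambda>n t. \<Sum>i<n. a i * \<phi> i (cis t) * h (cis t))"
  have "uniform_limit {0..2 * pi} S (\<lambda>t. \<Sum>i. a i * \<phi> i (cis t) * h (cis t)) sequentially"
    unfolding S_def
  proof (rule Weierstrass_m_test[where M = "\<lambda>i. cmod (a i) * B"])
    fix i t
    have "cmod (\<phi> i (cis t)) * cmod (h (cis t)) \<le> 1 * B"
      by (intro mult_mono B \<phi>(2)) auto
    then show "cmod (a i * \<phi> i (cis t) * h (cis t)) \<le> cmod (a i) * B"
      by (simp add: norm_mult mult.assoc mult_left_mono)
  qed (intro summable_mult2 a)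
  moreover have "continuous_on {0..2 * pi} (S n)" for n
    unfolding S_def by (intro continuous_intros continuous_on_circ_param \<phi> h)
  ultimately obtain I J where I: "\<And>n. (S n has_integral I n) {0..2 * pi}"
    and J: "((\<lambda>t. \<Sum>i. a i * \<phi> i (cis t) * h (cis t)) has_integral J) {0..2 * pi}"
    and lim: "I \<longlonglongrightarrow> J"
    by (rule uniform_limit_integral) auto
  have cont: "continuous_on (sphere 0 1) (\<lambda>z. a i * \<phi> i z * h z)" for i
    by (intro continuous_intros \<phi> h)
  have "I n / (2 * pi) = (\<Sum>i<n. a i * circ_mean (\<lambda>z. \<phi> i z * h z))" for n
  proof -
    have "I n / (2 * pi) = circ_mean (\<lambda>z. \<Sum>i<n. a i * \<phi> i z * h z)"
      using I[of n] unfolding circ_mean_def S_def by (simp add: integral_unique)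
    also have "\<dots> = (\<Sum>i<n. circ_mean (\<lambda>z. a i * \<phi> i z * h z))"
      by (intro circ_mean_sum cont) auto
    finally show ?thesis
      by (simp add: circ_mean_mult_left mult.assoc)
  qed
  moreover have "J / (2 * pi) = circ_mean (\<lambda>z. (\<Sum>i. a i * \<phi> i z) * h z)"
  proof -
    have "(\<Sum>i. a i * \<phi> i z * h z) = (\<Sum>i. a i * \<phi> i z) * h z" if "z \<in> sphere 0 1" for z
    proof (rule suminf_mult2[symmetric])
      show "summable (\<lambda>i. a i * \<phi> i z)"
        by (rule summable_comparison_test'[OF a])
          (use \<phi>(2)[OF that] in \<open>simp add: norm_mult mult_left_le\<close>)
    qed
    then have "circ_mean (\<lambda>z. (\<Sum>i. a i * \<phi> i z) * h z) = circ_mean (\<lambda>z. \<Sum>i. a i * \<phi> i z * h z)"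
      by (intro circ_mean_cong) simp
    then show ?thesis using J unfolding circ_mean_def by (simp add: integral_unique)
  qed
  ultimately show ?thesis
    using tendsto_divide[OF lim tendsto_const[of "complex_of_real (2 * pi)"]] by (simp add: sums_def)
qed

section \<open>Uniqueness of Fourier coefficients\<close>

lemma cnj_eq_inverse_on_circle:
  assumes "z \<in> sphere 0 1"
  shows "cnj z = inverse z"
proof -
  have "z * cnj z = 1" using assms by (simp flip: complex_norm_square)
  then show ?thesis by (metis inverse_unique)
qed

lemma continuous_on_real_polynomial_function:
  "real_polynomial_function p \<Longrightarrow> continuous_on S p"
  by (simp add: continuous_at_imp_continuous_on continuous_real_polymonial_function)

text \<open>
  The statement must quantify over all \<open>e\<close> with vanishing coefficients: only then does the induction
  pass through products.
\<close>
lemma circ_coeff_mult_poly: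
  assumes "real_polynomial_function p" "continuous_on (sphere 0 1) e" "\<And>n. circ_coeff e n = 0"
  shows "circ_coeff (\<lambda>z. of_real (p z) * e z) n = 0"
  using assms
proof (induction p arbitrary: e n rule: real_polynomial_function.induct)
  case (linear p)
  interpret bounded_linear p by fact
  \<comment> \<open>A real-linear functional on the plane is a combination of \<open>z\<close> and
    \<open>cnj z\<close>. On the circle \<open>cnj z\<close> is \<open>inverse z\<close>, so
    multiplying by \<open>p\<close> mixes the coefficients of index \<open>n - 1\<close> and
    \<open>n + 1\<close>.\<close>
  define \<alpha> where "\<alpha> = (of_real (p 1) - \<i> * of_real (p \<i>)) / 2"
  define \<beta> where "\<beta> = (of_real (p 1) + \<i> * of_real (p \<i>)) / 2"
  have p: "of_real (p z) = \<alpha> * z + \<beta> * cnj z" for z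
  proof -
    have "p z = p (Re z *\<^sub>R 1 + Im z *\<^sub>R \<i>)"
      by (rule arg_cong[where f = p]) (simp add: complex_eq_iff)
    also have "\<dots> = Re z * p 1 + Im z * p \<i>" by (simp only: add scaleR real_scaleR_def)
    finally show ?thesis
      unfolding \<alpha>_def \<beta>_def by (simp add: complex_eq_iff field_simps)
  qed
  have "circ_coeff (\<lambda>z. of_real (p z) * e z) n =
      circ_mean (\<lambda>z. \<alpha> * (e z * z powi (- (n - 1))) + \<beta> * (e z * z powi (- (n + 1))))"
    unfolding circ_coeff_def
  proof (rule circ_mean_cong)
    fix z :: complex assume z: "z \<in> sphere 0 1"
    then have z0: "z \<noteq> 0" and "cnj z = inverse z"
      by (auto simp: cnj_eq_inverse_on_circle)
    then have "z powi (- (n - 1)) = z * z powi (- n)" "z powi (- (n + 1)) = cnj z * z powi (- n)"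
      using power_int_add[of z 1 "- n"] power_int_add[of z "-1" "- n"] by (auto simp: algebra_simps)
    then show "of_real (p z) * e z * z powi - n =
        \<alpha> * (e z * z powi - (n - 1)) + \<beta> * (e z * z powi - (n + 1))"
      by (simp add: p algebra_simps)
  qed
  also have "\<dots> = \<alpha> * circ_coeff e (n - 1) + \<beta> * circ_coeff e (n + 1)"
    unfolding circ_coeff_def
    by (subst circ_mean_add)
      (auto intro!: continuous_intros linear.prems simp: circ_mean_mult_left)
  finally show ?case by (simp add: linear.prems)
next
  case (const c)
  then show ?case
    by (simp add: circ_coeff_def mult.assoc circ_mean_mult_left)
next
  case (add p q)
  have cont: "continuous_on (sphere 0 1) p" "continuous_on (sphere 0 1) q"
    using add.hyps by (auto intro: continuous_on_real_polynomial_function)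
  have "circ_coeff (\<lambda>z. of_real (p z + q z) * e z) n =
      circ_mean (\<lambda>z. of_real (p z) * e z * z powi - n + of_real (q z) * e z * z powi - n)"
    unfolding circ_coeff_def by (intro circ_mean_cong) (simp add: algebra_simps)
  also have "\<dots> = circ_coeff (\<lambda>z. of_real (p z) * e z) n + circ_coeff (\<lambda>z. of_real (q z) * e z) n"
    unfolding circ_coeff_def by (intro circ_mean_add continuous_intros cont add.prems)
  finally show ?case using add by simp
next
  case (mult p q)
  have cont: "continuous_on (sphere 0 1) q"
    using mult.hyps by (auto intro: continuous_on_real_polynomial_function)
  have "circ_coeff (\<lambda>z. of_real (p z) * (of_real (q z) * e z)) n = 0"
    by (intro mult.IH continuous_intros cont mult.prems)
  then show ?case by (simp add: mult.assoc)
qed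

text \<open>The mean of \<open>d^2\<close> equals the mean of \<open>d (d - p)\<close> plus that of
  \<open>p d\<close>. The second vanishes for every real polynomial \<open>p\<close>, and
  Stone-Weierstrass makes the first as small as desired. A continuous nonnegative function with zero
  integral is zero.\<close>

lemma circ_coeff_eq_0_imp_eq_0:
  fixes d :: "complex \<Rightarrow> real"
  assumes d: "continuous_on (sphere 0 1) d" and 0: "\<And>n. circ_coeff (\<lambda>z. of_real (d z)) n = 0"
    and z: "z \<in> sphere 0 1"
  shows "d z = 0"
proof -
  have "compact (d ` sphere 0 1)" by (intro compact_continuous_image d) auto
  then obtain B where B: "B > 0" "\<And>z. z \<in> sphere 0 1 \<Longrightarrow> \<bar>d z\<bar> \<le> B"
    by (metis bounded_pos compact_imp_bounded imageI real_norm_def)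
  have "cmod (circ_mean (\<lambda>z. of_real (d z ^ 2))) \<le> \<epsilon>" if "\<epsilon> > 0" for \<epsilon>
  proof -
    obtain p where p: "real_polynomial_function p"
      and close: "\<And>z. z \<in> sphere 0 1 \<Longrightarrow> \<bar>d z - p z\<bar> < \<epsilon> / B"
      using Stone_Weierstrass_real_polynomial_function[of "sphere 0 1" d "\<epsilon> / B"] d B(1) \<open>\<epsilon> > 0\<close>
      by auto
    have cont: "continuous_on (sphere 0 1) p"
      using p by (rule continuous_on_real_polynomial_function)
    have "circ_mean (\<lambda>z. of_real (d z ^ 2)) =
        circ_mean (\<lambda>z. of_real (d z * (d z - p z)) + of_real (p z) * of_real (d z))"
      by (intro circ_mean_cong) (simp add: algebra_simps power2_eq_square)
    also have "\<dots> = circ_mean (\<lambda>z. of_real (d z * (d z - p z)))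
        + circ_coeff (\<lambda>z. of_real (p z) * of_real (d z)) 0"
      unfolding circ_coeff_def by (subst circ_mean_add) (auto intro!: continuous_intros d cont)
    also have "circ_coeff (\<lambda>z. of_real (p z) * of_real (d z)) 0 = 0"
      by (intro circ_coeff_mult_poly p 0 continuous_intros d)
    also have "cmod (circ_mean (\<lambda>z. of_real (d z * (d z - p z))) + 0) \<le> B * (\<epsilon> / B)"
      unfolding add_0_right
    proof (rule norm_circ_mean_le_const)
      fix z :: complex assume "z \<in> sphere 0 1"
      then show "cmod (of_real (d z * (d z - p z))) \<le> B * (\<epsilon> / B)"
        unfolding norm_of_real abs_mult using B close by (intro mult_mono) (auto intro: less_imp_le)
    qed (intro continuous_intros d cont)
    finally show ?thesis using B(1) by simp
  qed
  then have "circ_mean (\<lambda>z. of_real (d z ^ 2)) = 0"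
    by (metis dense_ge norm_le_zero_iff)
  then have "integral {0..2 * pi} (\<lambda>t. d (cis t) ^ 2) = 0"
    by (subst (asm) circ_mean_of_real) (auto intro!: continuous_intros d)
  then have "\<forall>t\<in>{0..2 * pi}. d (cis t) ^ 2 = 0"
    by (subst (asm) integral_eq_0_iff) (auto intro!: continuous_intros continuous_on_circ_param d)
  moreover obtain t where "t \<in> {0..2 * pi}" "z = cis t" using sphere_cisE[OF z] by blast
  ultimately show ?thesis by simp
qed

section \<open>Coefficients of conjugates and of products with power series\<close>

lemma circ_coeff_cnj: "circ_coeff (\<lambda>z. cnj (h z)) n = cnj (circ_coeff h (- n))"
proof -
  have "circ_coeff (\<lambda>z. cnj (h z)) n = circ_mean (\<lambda>z. cnj (h z * z powi n))"
    unfolding circ_coeff_def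
  proof (rule circ_mean_cong)
    fix z :: complex assume z: "z \<in> sphere 0 1"
    have "cnj (z powi n) = cnj z powi n" by (simp add: power_int_def)
    also have "\<dots> = z powi - n"
      unfolding cnj_eq_inverse_on_circle[OF z] by (simp add: power_int_inverse power_int_minus)
    finally show "cnj (h z) * z powi - n = cnj (h z * z powi n)" by simp
  qed
  then show ?thesis unfolding circ_coeff_def by (simp only: circ_mean_cnj minus_minus)
qed

lemma circ_coeff_add:
  assumes "continuous_on (sphere 0 1) g" "continuous_on (sphere 0 1) h"
  shows "circ_coeff (\<lambda>z. g z + h z) n = circ_coeff g n + circ_coeff h n"
  unfolding circ_coeff_def distrib_right
  by (intro circ_mean_add continuous_intros assms)

lemma circ_coeff_minus: "circ_coeff (\<lambda>z. - h z) n = - circ_coeff h n"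
  unfolding circ_coeff_def using circ_mean_mult_left[of "-1"] by simp

lemma circ_coeff_cong:
  assumes "\<And>z. z \<in> sphere 0 1 \<Longrightarrow> g z = h z"
  shows "circ_coeff g n = circ_coeff h n"
  unfolding circ_coeff_def by (intro circ_mean_cong) (simp add: assms)

lemma circ_coeff_power_mult: "circ_coeff (\<lambda>z. z ^ i * h z) n = circ_coeff h (n - int i)"
  unfolding circ_coeff_def
proof (rule circ_mean_cong)
  fix z :: complex assume "z \<in> sphere 0 1"
  then have "z \<noteq> 0" by auto
  then show "z ^ i * h z * z powi - n = h z * z powi - (n - int i)"
    using power_int_add[of z "int i" "- n"] by (simp add: algebra_simps)
qed

lemma circ_coeff_1: "circ_coeff (\<lambda>z. 1) n = (if n = 0 then 1 else 0)"
  unfolding circ_coeff_def by (simp add: circ_mean_powi)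

text \<open>Multiplication by \<open>z ^ i\<close> raises frequencies by \<open>i\<close>. Hence
  after multiplication by a power series, coefficient \<open>n\<close> depends only on old
  coefficients of index at most \<open>n\<close>.\<close>

lemma circ_coeff_series_mult:
  assumes a: "summable (\<lambda>i. cmod (a i))" and h: "continuous_on (sphere 0 1) h"
    and g: "\<And>z. z \<in> sphere 0 1 \<Longrightarrow> (\<lambda>i. a i * z ^ i) sums g z"
  shows "(\<lambda>i. a i * circ_coeff h (n - int i)) sums circ_coeff (\<lambda>z. g z * h z) n"
proof -
  have "(\<lambda>i. a i * circ_mean (\<lambda>z. z ^ i * (h z * z powi - n))) sums
      circ_mean (\<lambda>z. (\<Sum>i. a i * z ^ i) * (h z * z powi - n))"
    by (intro circ_mean_series a continuous_intros h) (auto simp: norm_power)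
  also have "(\<lambda>i. circ_mean (\<lambda>z. z ^ i * (h z * z powi - n))) = (\<lambda>i. circ_coeff h (n - int i))"
    by (rule ext, subst circ_coeff_power_mult[symmetric]) (simp add: circ_coeff_def mult.assoc)
  also have "circ_mean (\<lambda>z. (\<Sum>i. a i * z ^ i) * (h z * z powi - n)) = circ_coeff (\<lambda>z. g z * h z) n"
    unfolding circ_coeff_def using g by (intro circ_mean_cong) (simp add: sums_iff mult.assoc)
  finally show ?thesis .
qed

text \<open>Mirror image of the preceding lemma, obtained by conjugating the whole product: now
  coefficient \<open>n\<close> sees only old coefficients of index at least
  \<open>n\<close>.\<close>

lemma circ_coeff_cnj_series_mult:
  assumes a: "summable (\<lambda>i. cmod (a i))" and h: "continuous_on (sphere 0 1) h"
    and g: "\<And>z. z \<in> sphere 0 1 \<Longrightarrow> (\<lambda>i. a i * z ^ i) sums g z"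
  shows "(\<lambda>i. cnj (a i) * circ_coeff h (n + int i)) sums circ_coeff (\<lambda>z. cnj (g z) * h z) n"
proof -
  have "(\<lambda>i. a i * circ_coeff (\<lambda>z. cnj (h z)) (- n - int i)) sums
      circ_coeff (\<lambda>z. g z * cnj (h z)) (- n)"
    by (intro circ_coeff_series_mult a g continuous_intros h)
  then have "(\<lambda>i. cnj (a i * circ_coeff (\<lambda>z. cnj (h z)) (- n - int i))) sums
      cnj (circ_coeff (\<lambda>z. g z * cnj (h z)) (- n))"
    by (simp only: sums_cnj)
  then show ?thesis
    by (simp add: circ_coeff_cnj algebra_simps flip: circ_coeff_cnj[of _ n])
qed

section \<open>Factorization of the symbol\<close>

text \<open>The solutions of \<open>exp w = 1\<close> are \<open>2 * pi\<close> apart, so a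
  continuous choice of them on a connected set is constant. Applied to differences of two logarithms
  of one function, this shows that logarithms agreeing at one point agree everywhere.\<close>

lemma exp_eq_1_imp_0_on_connected:
  fixes k :: "'a :: topological_space \<Rightarrow> complex"
  assumes S: "connected S" and k: "continuous_on S k" and exp: "\<And>x. x \<in> S \<Longrightarrow> exp (k x) = 1"
    and x0: "x0 \<in> S" "k x0 = 0" and x: "x \<in> S"
  shows "k x = 0"
proof -
  have "k constant_on S"
  proof (rule continuous_discrete_range_constant[OF S k])
    fix x assume x: "x \<in> S"
    have "2 * pi \<le> cmod (k y - k x)" if y: "y \<in> S" "k y \<noteq> k x" for y
    proof -
      have "exp (k y - k x) = 1" using exp x y by (simp add: exp_diff)
      then obtain n :: int where n: "Re (k y - k x) = 0" "Im (k y - k x) = of_int (2 * n) * pi"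
        unfolding exp_eq_1 by blast
      with y have "n \<noteq> 0" by (auto simp: complex_eq_iff)
      then have "1 \<le> \<bar>real_of_int n\<bar>" by linarith
      then have "2 * pi \<le> \<bar>Im (k y - k x)\<bar>"
        unfolding n by (simp add: abs_mult)
      then show ?thesis using abs_Im_le_cmod order_trans by blast
    qed
    then show "\<exists>e>0. \<forall>y. y \<in> S \<and> k y \<noteq> k x \<longrightarrow> e \<le> norm (k y - k x)"
      by (intro exI[of _ "2 * pi"]) auto
  qed
  then show ?thesis using x x0 unfolding constant_on_def by metis
qed

section \<open>Contour shift and the logarithm of the symbol on a strip\<close>

lemma convex_strip: "convex {w. a < Re w \<and> Re w < b}"
  using convex_Int[OF convex_halfspace_Re_gt[of a] convex_halfspace_Re_lt[of b]]
  by (simp add: Collect_conj_eq)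

lemma open_strip: "open {w. a < Re w \<and> Re w < b}"
  using open_Int[OF open_halfspace_Re_gt[of a] open_halfspace_Re_lt[of b]]
  by (simp add: Collect_conj_eq)

text \<open>In the coordinate \<open>w\<close> with \<open>z = exp w\<close> the circle becomes a
  vertical segment of length \<open>2 * pi\<close>. Moving it from real part 0 to real part
  \<open>x\<close> multiplies the kernel by \<open>exp (- n x)\<close> in modulus, while
  \<open>h\<close> on the new segment has a bound \<open>M\<close> free of \<open>n\<close>.\<close>

lemma circ_coeff_strip_decay:
  fixes a b :: real
  defines "V \<equiv> {w. a < Re w \<and> Re w < b}"
  assumes h: "h holomorphic_on V" and per: "\<And>w. w \<in> V \<Longrightarrow> h (w + 2 * pi * \<i>) = h w"
    and u: "\<And>t. u (cis t) = h (\<i> * of_real t)"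
    and x: "a < 0" "0 < x" "x < b"
  shows "\<exists>M. \<forall>n. cmod (circ_coeff u n) \<le> M * exp (- (of_int n * x))"
proof -
  have V: "convex V" "open V" unfolding V_def by (rule convex_strip open_strip)+
  have hx: "continuous_on {0..2 * pi} (\<lambda>t. h (of_real x + \<i> * of_real t))"
    by (rule continuous_on_compose2[OF holomorphic_on_imp_continuous_on[OF h]])
      (use x in \<open>auto intro!: continuous_intros simp: V_def\<close>)
  then have "compact ((\<lambda>t. h (of_real x + \<i> * of_real t)) ` {0..2 * pi})"
    by (rule compact_continuous_image) auto
  then obtain M where M: "\<And>t. t \<in> {0..2 * pi} \<Longrightarrow> cmod (h (of_real x + \<i> * of_real t)) \<le> M"
    by (meson bounded_iff compact_imp_bounded imageI)
  have "cmod (circ_coeff u n) \<le> M * exp (- (of_int n * x))" for n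
  proof -
    define G where "G w = h w * exp (- (of_int n * w))" for w
    have "G holomorphic_on V" unfolding G_def by (intro holomorphic_intros h)
    then obtain P where "\<And>w. w \<in> V \<Longrightarrow> (P has_field_derivative G w) (at w within V)"
      using holomorphic_convex_primitive'[OF V] by metis
    then have P: "(P has_field_derivative G w) (at w)" if "w \<in> V" for w
      using that V(2) by (metis at_within_open)
    have shift: "w + 2 * pi * \<i> \<in> V" if "w \<in> V" for w using that by (simp add: V_def)
    have Gper: "G (w + 2 * pi * \<i>) = G w" if "w \<in> V" for w
    proof -
      have "exp (- (of_int n * (w + 2 * pi * \<i>))) = exp (- (of_int n * w))"
        using exp_integer_2pi[of "of_int (- n)"] by (simp add: exp_diff algebra_simps)
      then show ?thesis using per[OF that] unfolding G_def by simp
    qed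
    \<comment> \<open>This plays the role of the cancelling horizontal sides in Cauchy's theorem for
      a rectangle: by periodicity of \<open>G\<close> the increment of its primitive over one period
      has derivative 0.\<close>
    have "(\<lambda>w. P (w + 2 * pi * \<i>) - P w) constant_on V"
    proof -
      have "((\<lambda>w. P (w + 2 * pi * \<i>) - P w) has_field_derivative 0) (at w within V)" if "w \<in> V" for w
      proof -
        have "((\<lambda>w. P (w + 2 * pi * \<i>)) has_field_derivative G (w + 2 * pi * \<i>)) (at w)"
          using P[OF shift[OF that]] by (subst (asm) DERIV_shift) 
        from DERIV_diff[OF this P[OF that]] show ?thesis
          using Gper[OF that] by (simp add: has_field_derivative_at_within)
      qed
      then show ?thesis
        unfolding constant_on_def by (rule has_field_derivative_zero_constant[OF V(1)])
    qed
    then obtain c where c: "\<And>w. w \<in> V \<Longrightarrow> P (w + 2 * pi * \<i>) - P w = c"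
      unfolding constant_on_def by blast
    have "of_real x \<in> V" "0 \<in> V" using x by (auto simp: V_def)
    then have eq: "P (of_real x + 2 * pi * \<i>) - P (of_real x) = P (0 + 2 * pi * \<i>) - P 0"
      by (simp only: c)
    \<comment> \<open>The integral over the vertical segment at real part \<open>y\<close> is the
      increment of \<open>P\<close>. It is used for \<open>y = 0\<close> and \<open>y = x\<close>,
      whose increments agree by \<open>eq\<close>.\<close>
    have int: "((\<lambda>t. \<i> * G (of_real y + \<i> * of_real t)) has_integral
        (P (of_real y + 2 * pi * \<i>) - P (of_real y))) {0..2 * pi}" if "a < y" "y < b" for y
    proof -
      have "((\<lambda>t. P (of_real y + \<i> * of_real t)) has_vector_derivative
          \<i> * G (of_real y + \<i> * of_real t)) (at t within {0..2 * pi})" for t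
      proof -
        have "((\<lambda>t. P (of_real y + \<i> * t)) has_field_derivative
            G (of_real y + \<i> * of_real t) * \<i>) (at (of_real t))"
          by (rule DERIV_chain2[OF P]) (use that in \<open>auto simp: V_def intro!: derivative_eq_intros\<close>)
        from has_vector_derivative_real_field[OF this] show ?thesis
          by (simp only: mult.commute[of \<i>])
      qed
      from fundamental_theorem_of_calculus[OF _ this] show ?thesis
        by (simp add: algebra_simps)
    qed
    have "circ_coeff u n = integral {0..2 * pi} (\<lambda>t. G (of_real 0 + \<i> * of_real t)) / (2 * pi)"
      unfolding circ_coeff_def circ_mean_def G_def
      by (intro arg_cong2[where f = "(/)"] integral_cong)
        (simp_all only: u cis_power_int, simp_all add: cis_conv_exp algebra_simps)
    also have "integral {0..2 * pi} (\<lambda>t. G (of_real 0 + \<i> * of_real t)) =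
        integral {0..2 * pi} (\<lambda>t. G (of_real x + \<i> * of_real t))"
    proof -
      have "\<i> * integral {0..2 * pi} (\<lambda>t. G (of_real 0 + \<i> * of_real t)) = P (0 + 2 * pi * \<i>) - P 0"
        using int[of 0] x by (simp add: integral_unique flip: integral_mult_right)
      moreover have "\<i> * integral {0..2 * pi} (\<lambda>t. G (of_real x + \<i> * of_real t)) =
          P (of_real x + 2 * pi * \<i>) - P (of_real x)"
        using int[of x] x by (simp add: integral_unique flip: integral_mult_right)
      ultimately show ?thesis using eq by (metis complex_i_not_zero mult_left_cancel)
    qed
    finally have coeff: "circ_coeff u n = integral {0..2 * pi} (\<lambda>t. G (of_real x + \<i> * of_real t)) / (2 * pi)" .
    have "cmod (integral {0..2 * pi} (\<lambda>t. G (of_real x + \<i> * of_real t))) \<le>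
        M * exp (- (of_int n * x)) * (2 * pi - 0)"
    proof (rule integral_bound)
      show "continuous_on {0..2 * pi} (\<lambda>t. G (of_real x + \<i> * of_real t))"
        unfolding G_def by (intro continuous_intros hx)
      fix t assume "t \<in> {0..2 * pi}"
      from M[OF this] show "cmod (G (of_real x + \<i> * of_real t)) \<le> M * exp (- (of_int n * x))"
        unfolding G_def by (simp add: norm_mult mult_right_mono)
    qed simp
    then show ?thesis unfolding coeff by (simp add: norm_divide field_simps)
  qed
  then show ?thesis by blast
qed

lemma circ_coeff_ln_decay:
  fixes f :: "complex \<Rightarrow> real"
  assumes r: "r1 < 1" "1 < r2" and ext: "extends_to_annulus f r1 r2"
    and pos: "\<And>z. z \<in> sphere 0 1 \<Longrightarrow> f z > 0" and cont: "continuous_on (sphere 0 1) f"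
    and R: "1 < R" "R < r2"
  shows "\<exists>M. \<forall>n. cmod (circ_coeff (\<lambda>z. of_real (ln (f z))) (int n)) \<le> M / R ^ n"
proof -
  obtain F where F: "F holomorphic_on annulus r1 r2" "\<And>z. z \<in> annulus r1 r2 \<Longrightarrow> F z \<noteq> 0"
    and Ff: "\<And>z. z \<in> sphere 0 1 \<Longrightarrow> F z = of_real (f z)"
    using ext unfolding extends_to_annulus_def by blast
  \<comment> \<open>\<open>r1\<close> may be zero or negative. The maximum with 1/2 gives a positive
    radius, still below 1, whose logarithm is a valid left edge of the strip.\<close>
  define a where "a = ln (max r1 (1 / 2))"
  define b where "b = ln r2"
  define V where "V = {w. a < Re w \<and> Re w < b}"
  have a: "a < 0" and b: "0 < b" unfolding a_def b_def using r by (auto simp: ln_less_zero)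
  have V: "convex V" "open V" unfolding V_def by (rule convex_strip open_strip)+
  have expV: "exp w \<in> annulus r1 r2" if "w \<in> V" for w
  proof -
    have "exp a < exp (Re w)" "exp (Re w) < exp b" using that by (auto simp: V_def)
    then show ?thesis using r by (simp add: annulus_def a_def b_def)
  qed
  have "(\<lambda>w. F (exp w)) holomorphic_on V"
    using holomorphic_on_compose_gen[of exp V F "annulus r1 r2"] F(1) expV
    by (auto simp: o_def holomorphic_on_exp)
  moreover have 0: "0 \<in> V" using a b by (simp add: V_def)
  ultimately obtain h0 where h0: "h0 holomorphic_on V" "\<And>w. w \<in> V \<Longrightarrow> exp (h0 w) = F (exp w)"
    using holomorphic_logarithm_exists[OF V, of "\<lambda>w. F (exp w)" 0] F(2) expV by metis
  \<comment> \<open>The subtracted constant is a logarithm of 1, since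
    \<open>exp (h0 0) = F 1 = f 1\<close>. So \<open>h\<close> is still a logarithm of
    \<open>F (exp w)\<close>, now with the real value \<open>ln (f 1)\<close> at 0.\<close>
  define h where "h w = h0 w - (h0 0 - of_real (ln (f 1)))" for w
  have h: "h holomorphic_on V" unfolding h_def by (intro holomorphic_intros h0)
  have hc: "continuous_on V h" using h by (rule holomorphic_on_imp_continuous_on)
  have ln_f: "exp (of_real (ln (f z)) :: complex) = of_real (f z)" if "z \<in> sphere 0 1" for z
    using pos[OF that] exp_of_real[of "ln (f z)", where 'a = complex] by simp
  have hexp: "exp (h w) = F (exp w)" if "w \<in> V" for w
    using h0(2)[OF that] h0(2)[OF 0] Ff[of 1] pos[of 1] ln_f[of 1] by (simp add: h_def exp_diff)
  define k where "k t = h (\<i> * of_real t) - of_real (ln (f (cis t)))" for t :: real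
  have k0: "k t = 0" for t
  proof (rule exp_eq_1_imp_0_on_connected[of UNIV k 0])
    show "continuous_on UNIV k"
      unfolding k_def
    proof (rule continuous_on_diff)
      show "continuous_on UNIV (\<lambda>t. h (\<i> * of_real t))"
        by (rule continuous_on_compose2[OF hc])
          (use a b in \<open>auto simp: V_def intro!: continuous_intros\<close>)
      have "f (cis t) \<noteq> 0" for t using pos[of "cis t"] by simp
      then show "continuous_on UNIV (\<lambda>t. of_real (ln (f (cis t))) :: complex)"
        by (intro continuous_on_of_real continuous_on_ln continuous_on_circ_param cont) auto
    qed
    show "exp (k t) = 1" for t
      using hexp[of "\<i> * of_real t"] a b Ff[of "cis t"] pos[of "cis t"] ln_f[of "cis t"]
      by (simp add: k_def exp_diff V_def cis_conv_exp[symmetric])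
  qed (auto simp: h_def k_def)
  then have axis: "h (\<i> * of_real t) = of_real (ln (f (cis t)))" for t by (simp add: k_def)
  \<comment> \<open>A logarithm could gain a multiple of \<open>2 * pi * \<i>\<close> over one
    period. There is no such winding here, because on the imaginary axis \<open>h\<close> is
    \<open>ln (f (cis t))\<close>, which returns to its initial value.\<close>
  define k' where "k' w = h (w + 2 * pi * \<i>) - h w" for w
  have shift: "w + 2 * pi * \<i> \<in> V" if "w \<in> V" for w using that by (simp add: V_def)
  have "k' w = 0" if "w \<in> V" for w
  proof (rule exp_eq_1_imp_0_on_connected[of V k' 0])
    show "connected V" using V(1) by (rule convex_connected)
    show "continuous_on V k'"
      unfolding k'_def
      by (intro continuous_intros hc continuous_on_compose2[OF hc]) (use shift in auto)
    show "exp (k' w) = 1" if "w \<in> V" for w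
      using hexp[OF that] hexp[OF shift[OF that]] F(2)[OF expV[OF that]]
      by (simp add: k'_def exp_diff exp_add)
    have "h (\<i> * of_real (2 * pi)) = of_real (ln (f 1))"
      using axis[of "2 * pi"] by (simp only: cis_2pi)
    then show "k' 0 = 0"
      using axis[of 0] by (simp add: k'_def mult.commute)
  qed (use 0 that in auto)
  then have per: "h (w + 2 * pi * \<i>) = h w" if "w \<in> V" for w
    using that by (simp add: k'_def)
  \<comment> \<open>Shifting to \<open>x = ln R\<close> turns the factor \<open>exp (- n x)\<close>
    into \<open>R ^ n\<close> in the denominator.\<close>
  have "\<exists>M. \<forall>n. cmod (circ_coeff (\<lambda>z. of_real (ln (f z))) n) \<le> M * exp (- (of_int n * ln R))"
  proof (rule circ_coeff_strip_decay[where a = a and b = b and h = h])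
    show "of_real (ln (f (cis t))) = h (\<i> * of_real t)" for t using axis[of t] by (rule sym)
  qed (use h per a b R in \<open>auto simp: V_def b_def\<close>)
  then obtain M where
    M: "\<And>n. cmod (circ_coeff (\<lambda>z. of_real (ln (f z))) n) \<le> M * exp (- (of_int n * ln R))" by blast
  have "exp (- (of_int (int n) * ln R)) = 1 / R ^ n" for n
    using R by (simp add: exp_minus exp_of_nat_mult inverse_eq_divide)
  then show ?thesis using M by (metis (no_types) times_divide_eq_right mult.right_neutral)
qed

section \<open>Splitting the logarithm and estimating Taylor coefficients\<close>

lemma summable_geometric_bound:
  fixes a :: "nat \<Rightarrow> complex"
  assumes "\<And>n. cmod (a n) \<le> M / R ^ n" "0 \<le> r" "r < R"
  shows "summable (\<lambda>n. cmod (a n) * r ^ n)"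
proof (rule summable_comparison_test')
  show "summable (\<lambda>n. M * (r / R) ^ n)"
    using assms by (intro summable_mult summable_geometric) auto
  show "norm (cmod (a n) * r ^ n) \<le> M * (r / R) ^ n" for n
    using mult_right_mono[OF assms(1)[of n], of "r ^ n"] assms(2) by (simp add: power_divide)
qed

text \<open>Since \<open>ln f\<close> is real, its coefficients of index \<open>n\<close> and
  \<open>- n\<close> are conjugate. The nonnegative half therefore determines it:
  \<open>A + cnj A\<close> has the coefficients of \<open>ln f\<close> and equals it by uniqueness.
  The decay of the coefficients makes the series of \<open>A\<close> converge for
  \<open>cmod z < R\<close>.\<close>

lemma positive_annulus_factor:
  fixes f :: "complex \<Rightarrow> real"
  assumes r: "r1 < 1" "1 < r2" and ext: "extends_to_annulus f r1 r2"
    and pos: "\<And>z. z \<in> sphere 0 1 \<Longrightarrow> f z > 0" and cont: "continuous_on (sphere 0 1) f"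
    and R: "1 < R" "R < r2"
  obtains A where "A holomorphic_on ball 0 R"
    and "\<And>z. z \<in> sphere 0 1 \<Longrightarrow> f z = exp (2 * Re (A z))"
proof -
  define u where "u z = ln (f z)" for z
  have "f z \<noteq> 0" if "z \<in> sphere 0 1" for z using pos[OF that] by simp
  then have u: "continuous_on (sphere 0 1) u"
    unfolding u_def by (intro continuous_on_ln cont) auto
  define c where "c n = circ_coeff (\<lambda>z. of_real (u z)) n" for n
  have c_cnj: "c n = cnj (c (- n))" for n
    unfolding c_def by (subst circ_coeff_cnj[symmetric]) simp
  obtain M where M: "\<And>n. cmod (c (int n)) \<le> M / R ^ n"
    using circ_coeff_ln_decay[OF r ext pos cont R] unfolding c_def u_def by blast
  \<comment> \<open>The zeroth coefficient is halved because it occurs in both \<open>A\<close> and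
    \<open>cnj A\<close>.\<close>
  define a where "a n = (if n = 0 then c 0 / 2 else c (int n))" for n
  have a: "cmod (a n) \<le> M / R ^ n" for n
    using M[of n] norm_ge_zero[of "c 0"] by (auto simp: a_def simp del: norm_ge_zero)
  define A where "A z = (\<Sum>n. a n * z ^ n)" for z
  have sums: "(\<lambda>n. a n * z ^ n) sums A z" if "cmod z < R" for z
    unfolding A_def
    using summable_geometric_bound[OF a _ that]
    by (intro summable_sums summable_norm_cancel[where f = "\<lambda>n. a n * z ^ n"])
      (simp add: norm_mult norm_power)
  have holo: "A holomorphic_on ball 0 R"
    by (rule power_series_holomorphic[where a = a]) (simp add: sums)
  have sums1: "(\<lambda>n. a n * z ^ n) sums A z" if "z \<in> sphere 0 1" for z
    using sums[of z] that R by simp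
  have suma: "summable (\<lambda>n. cmod (a n))"
    using summable_geometric_bound[OF a, of 1] R by simp
  have contA: "continuous_on (sphere 0 1) A"
    by (rule continuous_on_subset[OF holomorphic_on_imp_continuous_on[OF holo]]) (use R in auto)
  have coeffA: "circ_coeff A n = (if n \<ge> 0 then a (nat n) else 0)" for n
  proof -
    have "(\<lambda>i. a i * circ_coeff (\<lambda>z. 1) (n - int i)) sums circ_coeff (\<lambda>z. A z * 1) n"
      by (intro circ_coeff_series_mult suma sums1 continuous_intros)
    \<comment> \<open>For negative \<open>n\<close>, \<open>nat n\<close> is 0, hence the inner
      test, which makes that single term vanish.\<close>
    moreover have "(\<lambda>i. a i * circ_coeff (\<lambda>z. 1) (n - int i)) =
        (\<lambda>i. if i = nat n then (if n \<ge> 0 then a i else 0) else 0)"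
      by (auto simp: circ_coeff_1)
    ultimately show ?thesis
      using sums_unique2[OF sums_single[of "nat n" "\<lambda>i. if n \<ge> 0 then a i else 0"]] by simp
  qed
  define d where "d z = u z - 2 * Re (A z)" for z
  have d0: "d z = 0" if "z \<in> sphere 0 1" for z
  proof (rule circ_coeff_eq_0_imp_eq_0[OF _ _ that])
    show "continuous_on (sphere 0 1) d" unfolding d_def by (intro continuous_intros u contA)
    fix n
    have "circ_coeff (\<lambda>z. of_real (d z)) n =
        circ_coeff (\<lambda>z. of_real (u z) + (- A z + - cnj (A z))) n"
      by (rule circ_coeff_cong) (simp add: d_def complex_eq_iff)
    also have "\<dots> = c n + (- circ_coeff A n + - cnj (circ_coeff A (- n)))"
    proof -
      have "circ_coeff (\<lambda>z. of_real (u z) + (- A z + - cnj (A z))) n =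
          c n + circ_coeff (\<lambda>z. - A z + - cnj (A z)) n"
        unfolding c_def by (intro circ_coeff_add continuous_intros u contA)
      also have "circ_coeff (\<lambda>z. - A z + - cnj (A z)) n =
          circ_coeff (\<lambda>z. - A z) n + circ_coeff (\<lambda>z. - cnj (A z)) n"
        by (intro circ_coeff_add continuous_intros contA)
      finally show ?thesis by (simp only: circ_coeff_minus circ_coeff_cnj)
    qed
    also have "\<dots> = 0"
    proof -
      consider "n = 0" | "n > 0" | "n < 0" by linarith
      then show ?thesis
      proof cases
        case 1
        have "Im (c 0) = 0" using arg_cong[OF c_cnj[of 0], of Im] by simp
        then show ?thesis by (simp add: 1 coeffA a_def complex_eq_iff)
      next
        case 3
        have "c n = cnj (circ_coeff A (- n))" using 3 by (simp add: coeffA a_def flip: c_cnj)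
        then show ?thesis using 3 by (simp add: coeffA)
      qed (simp add: coeffA a_def)
    qed
    finally show "circ_coeff (\<lambda>z. of_real (d z)) n = 0" .
  qed
  have "f z = exp (2 * Re (A z))" if "z \<in> sphere 0 1" for z
  proof -
    have "2 * Re (A z) = ln (f z)" using d0[OF that] by (simp add: d_def u_def)
    then show ?thesis using pos[OF that] by simp
  qed
  with holo show ?thesis using that by blast
qed

text \<open>Cauchy's inequality on the circle of radius \<open>r\<close>. Taking
  \<open>r < R\<close> puts the closed disc inside the domain, where \<open>g\<close> is
  bounded.\<close>

lemma holomorphic_coeff_decay:
  assumes g: "g holomorphic_on ball 0 R" and "0 < r" "r < R"
  obtains b B where "\<And>z. cmod z < R \<Longrightarrow> (\<lambda>n. b n * z ^ n) sums g z"
    and "\<And>n. cmod (b n) \<le> B / r ^ n"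
proof -
  define b where "b n = (deriv ^^ n) g 0 / fact n" for n
  have sub: "cball 0 r \<subseteq> ball (0::complex) R" using assms by auto
  have cont: "continuous_on (cball 0 r) g"
    using continuous_on_subset[OF holomorphic_on_imp_continuous_on[OF g] sub] .
  then have "compact (g ` cball 0 r)" by (rule compact_continuous_image) auto
  then obtain B where B: "\<And>z. z \<in> cball 0 r \<Longrightarrow> cmod (g z) \<le> B"
    by (meson bounded_iff compact_imp_bounded imageI)
  have "cmod ((deriv ^^ n) g 0) \<le> fact n * B / r ^ n" for n
  proof (rule Cauchy_inequality[OF holomorphic_on_subset[OF g] cont \<open>0 < r\<close>])
    show "ball 0 r \<subseteq> ball (0::complex) R" using assms by auto
  qed (use B in auto)
  then have "cmod (b n) \<le> B / r ^ n" for n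
    using \<open>0 < r\<close> by (simp add: b_def norm_divide field_simps)
  moreover have "(\<lambda>n. b n * z ^ n) sums g z" if "cmod z < R" for z
    using holomorphic_power_series[OF g, of z] that by (simp add: b_def)
  ultimately show ?thesis using that by blast
qed

section \<open>Toeplitz systems\<close>

text \<open>Leading zeros become decay: a geometrically dominated series that starts at index
  \<open>j\<close> gains the factor \<open>\<rho> ^ j\<close> in the denominator. With
  \<open>j = 0\<close> it is a plain bound.\<close>

lemma norm_sums_geometric_tail:
  fixes t :: "nat \<Rightarrow> complex"
  assumes s: "t sums S" and \<rho>: "1 < \<rho>" and t: "\<And>i. cmod (t i) \<le> c / \<rho> ^ i"
    and 0: "\<And>i. i < j \<Longrightarrow> t i = 0"
  shows "cmod S \<le> c / (1 - 1 / \<rho>) / \<rho> ^ j"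
proof -
  have "(\<lambda>i. t (i + j)) sums (S - (\<Sum>i<j. t i))" using s by (rule sums_split_initial_segment)
  then have s': "(\<lambda>i. t (i + j)) sums S" using 0 by simp
  have "(\<lambda>i. (1 / \<rho>) ^ i) sums (1 / (1 - 1 / \<rho>))"
    using \<rho> by (intro geometric_sums) simp
  then have g: "(\<lambda>i. c / \<rho> ^ j * (1 / \<rho>) ^ i) sums (c / \<rho> ^ j * (1 / (1 - 1 / \<rho>)))"
    by (rule sums_mult)
  have "cmod (\<Sum>i. t (i + j)) \<le> (\<Sum>i. c / \<rho> ^ j * (1 / \<rho>) ^ i)"
  proof (rule norm_suminf_le)
    show "cmod (t (i + j)) \<le> c / \<rho> ^ j * (1 / \<rho>) ^ i" for i
      using t[of "i + j"] by (simp add: power_add power_divide mult.commute)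
  qed (use g in \<open>simp add: sums_iff\<close>)
  then show ?thesis using s' g by (simp add: sums_iff mult.commute)
qed

section \<open>Polynomials and the quadratic form of the Toeplitz matrix\<close>

lemma circ_coeff_mult_sum_power:
  assumes "continuous_on (sphere 0 1) h"
  shows "circ_coeff (\<lambda>z. h z * (\<Sum>j\<le>N. v j * z ^ j)) n = (\<Sum>j\<le>N. v j * circ_coeff h (n - int j))"
proof -
  have "circ_coeff (\<lambda>z. h z * (\<Sum>j\<le>N. v j * z ^ j)) n =
      circ_mean (\<lambda>z. \<Sum>j\<le>N. v j * (z ^ j * h z * z powi - n))"
    unfolding circ_coeff_def
    by (intro circ_mean_cong) (simp add: sum_distrib_left sum_distrib_right algebra_simps)
  also have "\<dots> = (\<Sum>j\<le>N. circ_mean (\<lambda>z. v j * (z ^ j * h z * z powi - n)))"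
    by (intro circ_mean_sum continuous_intros assms) auto
  also have "\<dots> = (\<Sum>j\<le>N. v j * circ_coeff h (n - int j))"
    by (simp add: circ_mean_mult_left circ_coeff_power_mult flip: circ_coeff_def)
  finally show ?thesis .
qed

lemma circ_coeff_sum_power:
  "circ_coeff (\<lambda>z. \<Sum>j\<le>N. v j * z ^ j) (int n) = (if n \<le> N then v n else 0)"
  "m < 0 \<Longrightarrow> circ_coeff (\<lambda>z. \<Sum>j\<le>N. v j * z ^ j) m = 0"
proof -
  have eq: "circ_coeff (\<lambda>z. \<Sum>j\<le>N. v j * z ^ j) m = (\<Sum>j\<le>N. if m = int j then v j else 0)" for m
    using circ_coeff_mult_sum_power[of "\<lambda>z. 1" v N m]
    by (simp add: circ_coeff_1 if_distrib cong: if_cong)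
  show "circ_coeff (\<lambda>z. \<Sum>j\<le>N. v j * z ^ j) (int n) = (if n \<le> N then v n else 0)"
    unfolding eq by simp
  show "circ_coeff (\<lambda>z. \<Sum>j\<le>N. v j * z ^ j) m = 0" if "m < 0"
    unfolding eq using that by (intro sum.neutral) auto
qed

text \<open>Expanding one factor of \<open>cmod (p v N z) ^ 2\<close> as a sum of
  \<open>cnj (v n) * z powi - int n\<close> yields coefficients of \<open>f p\<close>. Positivity of
  \<open>f\<close> thereby becomes positive definiteness of the matrix.\<close>

lemma toeplitz_quadratic_form:
  fixes f :: "complex \<Rightarrow> real"
  assumes f: "continuous_on (sphere 0 1) f"
  defines "p \<equiv> (\<lambda>v N z. \<Sum>j\<le>N. v j * z ^ j)"
  shows "circ_mean (\<lambda>z. of_real (f z * cmod (p v N z) ^ 2)) =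
    (\<Sum>n\<le>N. cnj (v n) * (\<Sum>j\<le>N. v j * circ_coeff (\<lambda>z. of_real (f z)) (int n - int j)))"
proof -
  have fc: "continuous_on (sphere 0 1) (\<lambda>z. of_real (f z) :: complex)"
    by (intro continuous_intros f)
  have pc: "continuous_on (sphere 0 1) (p v N)" unfolding p_def by (intro continuous_intros)
  have "circ_mean (\<lambda>z. of_real (f z * cmod (p v N z) ^ 2)) =
      circ_mean (\<lambda>z. \<Sum>n\<le>N. cnj (v n) * (of_real (f z) * p v N z * z powi - int n))"
  proof (rule circ_mean_cong)
    fix z :: complex assume z: "z \<in> sphere 0 1"
    have "cnj (p v N z) = (\<Sum>n\<le>N. cnj (v n) * z powi - int n)"
      unfolding p_def by (simp add: cnj_eq_inverse_on_circle[OF z] power_int_minus power_inverse)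
    then show "of_real (f z * cmod (p v N z) ^ 2) =
        (\<Sum>n\<le>N. cnj (v n) * (of_real (f z) * p v N z * z powi - int n))"
      unfolding of_real_mult complex_norm_square by (simp add: sum_distrib_left algebra_simps)
  qed
  also have "\<dots> = (\<Sum>n\<le>N. circ_mean (\<lambda>z. cnj (v n) * (of_real (f z) * p v N z * z powi - int n)))"
    by (intro circ_mean_sum continuous_intros fc pc) auto
  also have "\<dots> = (\<Sum>n\<le>N. cnj (v n) * circ_coeff (\<lambda>z. of_real (f z) * p v N z) (int n))"
    by (simp add: circ_mean_mult_left circ_coeff_def)
  finally show ?thesis unfolding p_def circ_coeff_mult_sum_power[OF fc] .
qed

text \<open>Pairing the system with \<open>v\<close> itself shows that the energy \<open>E\<close>,
  the mean of \<open>f |p|^2\<close>, is at most \<open>|v l|\<close>. An AM-GM estimate of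
  \<open>|v l|\<close> in terms of \<open>E\<close> closes the loop, and a second one bounds
  \<open>f p\<close>. The bound involves neither \<open>N\<close> nor \<open>l\<close>.\<close>

lemma toeplitz_solution_residual_bounded:
  fixes f :: "complex \<Rightarrow> real"
  assumes f: "continuous_on (sphere 0 1) f"
    and m: "0 < m" "\<And>z. z \<in> sphere 0 1 \<Longrightarrow> m \<le> f z" and M: "\<And>z. z \<in> sphere 0 1 \<Longrightarrow> f z \<le> M"
    and l: "l \<le> N"
    and v: "\<And>n. n \<le> N \<Longrightarrow>
      (\<Sum>j\<le>N. v j * circ_coeff (\<lambda>z. of_real (f z)) (int n - int j)) = (if n = l then 1 else 0)"
  shows "cmod (circ_coeff (\<lambda>z. of_real (f z) * (\<Sum>j\<le>N. v j * z ^ j)) n) \<le> (M + 1 / m) / 2"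
proof -
  define p where "p z = (\<Sum>j\<le>N. v j * z ^ j)" for z
  have pc: "continuous_on (sphere 0 1) p" unfolding p_def by (intro continuous_intros)
  define E where "E = Re (circ_mean (\<lambda>z. of_real (f z * cmod (p z) ^ 2)))"
  have "circ_mean (\<lambda>z. of_real (f z * cmod (p z) ^ 2)) = cnj (v l)"
    unfolding p_def toeplitz_quadratic_form[OF f] using l by (simp add: v if_distrib cong: if_cong)
  then have "E = Re (v l)" by (simp add: E_def)
  then have E: "E \<le> cmod (v l)" using complex_Re_le_cmod by simp
  \<comment> \<open>Common end of both AM-GM estimates, used with \<open>c = 1 / m\<close> and with
    \<open>c = M\<close>.\<close>
  have mean: "cmod (circ_mean h) \<le> (c + E) / 2"
    if "continuous_on (sphere 0 1) h" "\<And>z. z \<in> sphere 0 1 \<Longrightarrow> 2 * cmod (h z) \<le> c + f z * cmod (p z) ^ 2"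
    for h c
  proof -
    have "cmod (circ_mean h) \<le> Re (circ_mean (\<lambda>z. of_real ((c + f z * cmod (p z) ^ 2) / 2)))"
      using that(2) by (intro norm_circ_mean_le that continuous_intros f pc) (auto simp: field_simps)
    also have "circ_mean (\<lambda>z. of_real ((c + f z * cmod (p z) ^ 2) / 2)) =
        circ_mean (\<lambda>z. 1 / 2 * (of_real c + of_real (f z * cmod (p z) ^ 2)))"
      by (intro circ_mean_cong) simp
    also have "\<dots> = 1 / 2 * (of_real c + circ_mean (\<lambda>z. of_real (f z * cmod (p z) ^ 2)))"
      unfolding circ_mean_mult_left
      by (subst circ_mean_add) (auto intro!: continuous_intros f pc simp: circ_mean_const)
    finally show ?thesis by (simp add: E_def)
  qed
  have "cmod (circ_mean (\<lambda>z. p z * z powi - int l)) \<le> (1 / m + E) / 2"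
  proof (rule mean)
    fix z :: complex assume z: "z \<in> sphere 0 1"
    \<comment> \<open>AM-GM: \<open>2 |p| \<le> 1/m + m |p|\<^sup>2\<close>\<close>
    have "0 \<le> (m * cmod (p z) - 1) ^ 2 / m" using m by simp
    also have "\<dots> = 1 / m + m * cmod (p z) ^ 2 - 2 * cmod (p z)"
      using m by (simp add: field_simps power2_eq_square)
    also have "m * cmod (p z) ^ 2 \<le> f z * cmod (p z) ^ 2"
      using m(2)[OF z] by (intro mult_right_mono) auto
    finally show "2 * cmod (p z * z powi - int l) \<le> 1 / m + f z * cmod (p z) ^ 2"
      using z by (simp add: norm_mult norm_power_int)
  qed (intro continuous_intros pc)
  also have "circ_mean (\<lambda>z. p z * z powi - int l) = v l"
    using circ_coeff_sum_power(1)[of v N l] l unfolding p_def circ_coeff_def by simp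
  \<comment> \<open>From \<open>E \<le> cmod (v l) \<le> (1 / m + E) / 2\<close>, half of
    \<open>E\<close> is absorbed on the left.\<close>
  finally have E': "E \<le> 1 / m" using E by simp
  have "cmod (circ_coeff (\<lambda>z. of_real (f z) * p z) n) \<le> (M + E) / 2"
    unfolding circ_coeff_def
  proof (rule mean)
    fix z :: complex assume z: "z \<in> sphere 0 1"
    then have fz: "0 < f z" using m by force
    have "0 \<le> f z * (cmod (p z) - 1) ^ 2" using fz by simp
    also have "\<dots> = f z + f z * cmod (p z) ^ 2 - 2 * (f z * cmod (p z))"
      by (simp add: algebra_simps power2_eq_square)
    finally show "2 * cmod (of_real (f z) * p z * z powi - n) \<le> M + f z * cmod (p z) ^ 2"
      using M[OF z] fz z by (simp add: norm_mult norm_power_int)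
  qed (intro continuous_intros pc f)
  then show ?thesis using E' unfolding p_def by simp
qed

lemma positive_continuous_bounds:
  fixes f :: "complex \<Rightarrow> real"
  assumes f: "continuous_on (sphere 0 1) f" and pos: "\<And>z. z \<in> sphere 0 1 \<Longrightarrow> f z > 0"
  obtains m M where "0 < m" "\<And>z. z \<in> sphere 0 1 \<Longrightarrow> m \<le> f z" "\<And>z. z \<in> sphere 0 1 \<Longrightarrow> f z \<le> M"
proof -
  have *: "compact (sphere (0::complex) 1)" "sphere (0::complex) 1 \<noteq> {}" by auto
  obtain x where "x \<in> sphere 0 1" "\<And>z. z \<in> sphere 0 1 \<Longrightarrow> f x \<le> f z"
    using continuous_attains_inf[OF * f] by blast
  moreover obtain y where "\<And>z. z \<in> sphere 0 1 \<Longrightarrow> f z \<le> f y"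
    using continuous_attains_sup[OF * f] by blast
  ultimately show ?thesis using that pos by blast
qed

text \<open>\<open>C\<close> is chosen before \<open>N\<close>, \<open>l\<close>, \<open>v\<close>
  and \<open>k\<close>, which gives uniformity. The vector \<open>v\<close> is an arbitrary solution
  of the system, so that both columns and conjugated rows of the inverse qualify.\<close>

lemma toeplitz_solution_decay:
  fixes f :: "complex \<Rightarrow> real"
  assumes f: "continuous_on (sphere 0 1) f" and pos: "\<And>z. z \<in> sphere 0 1 \<Longrightarrow> f z > 0"
    and A: "A holomorphic_on ball 0 R" and fA: "\<And>z. z \<in> sphere 0 1 \<Longrightarrow> f z = exp (2 * Re (A z))"
    and \<rho>: "1 < \<rho>" "\<rho> < R"
  shows "\<exists>C. \<forall>N l v k. l \<le> N \<longrightarrow> k \<le> l \<longrightarrow>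
    (\<forall>n\<le>N. (\<Sum>j\<le>N. v j * circ_coeff (\<lambda>z. of_real (f z)) (int n - int j)) = (if n = l then 1 else 0)) \<longrightarrow>
    cmod (v k) \<le> C / \<rho> ^ (l - k)"
proof -
  obtain m M where m: "0 < m" "\<And>z. z \<in> sphere 0 1 \<Longrightarrow> m \<le> f z"
    and M: "\<And>z. z \<in> sphere 0 1 \<Longrightarrow> f z \<le> M"
    using positive_continuous_bounds[OF f pos] by blast
  define K where "K = (M + 1 / m) / 2"
  have contA: "continuous_on (sphere 0 1) A"
    by (rule continuous_on_subset[OF holomorphic_on_imp_continuous_on[OF A]]) (use \<rho> in auto)
  have fc: "continuous_on (sphere 0 1) (\<lambda>z. of_real (f z) :: complex)"
    by (intro continuous_intros f)
  have \<rho>0: "0 < \<rho>" using \<rho> by simp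
  have holb: "(\<lambda>z. exp (- A z)) holomorphic_on ball 0 R" by (intro holomorphic_intros A)
  obtain b B where b: "\<And>z. cmod z < R \<Longrightarrow> (\<lambda>n. b n * z ^ n) sums exp (- A z)"
    and B: "\<And>n. cmod (b n) \<le> B / \<rho> ^ n"
    using holomorphic_coeff_decay[OF holb \<rho>0 \<rho>(2)] by blast
  have hola: "(\<lambda>z. exp (A z)) holomorphic_on ball 0 R" by (intro holomorphic_intros A)
  obtain a B' where a: "\<And>z. cmod z < R \<Longrightarrow> (\<lambda>n. a n * z ^ n) sums exp (A z)"
    and B': "\<And>n. cmod (a n) \<le> B' / \<rho> ^ n"
    using holomorphic_coeff_decay[OF hola \<rho>0 \<rho>(2)] by blast
  have sb: "summable (\<lambda>n. cmod (b n))" using summable_geometric_bound[OF B, of 1] \<rho> by simp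
  have sa: "summable (\<lambda>n. cmod (a n))" using summable_geometric_bound[OF B', of 1] \<rho> by simp
  have B0: "B \<ge> 0" using order_trans[OF norm_ge_zero B[of 0]] by simp
  define D where "D = 1 / (1 - 1 / \<rho>)"
  have "cmod (v k) \<le> B * (B * K * D) * D / \<rho> ^ (l - k)"
    if l: "l \<le> N" and k: "k \<le> l" and v: "\<And>n. n \<le> N \<Longrightarrow>
      (\<Sum>j\<le>N. v j * circ_coeff (\<lambda>z. of_real (f z)) (int n - int j)) = (if n = l then 1 else 0)"
    for N l v k
  proof -
    define p where "p z = (\<Sum>j\<le>N. v j * z ^ j)" for z
    have pc: "continuous_on (sphere 0 1) p" unfolding p_def by (intro continuous_intros)
    define w where "w z = of_real (f z) * p z" for z
    have wc: "continuous_on (sphere 0 1) w" unfolding w_def by (intro continuous_intros fc pc)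
    have w_bound: "cmod (circ_coeff w n) \<le> K" for n
      unfolding w_def p_def K_def by (rule toeplitz_solution_residual_bounded[OF f m M l v])
    have w_eq: "circ_coeff w (int n) = (if n = l then 1 else 0)" if "n \<le> N" for n
      unfolding w_def p_def circ_coeff_mult_sum_power[OF fc] by (rule v[OF that])
    \<comment> \<open>\<open>q\<close> has two descriptions. As \<open>exp A\<close> times a
      polynomial it has no negative frequencies; as \<open>cnj (exp (- A))\<close> times
      \<open>w\<close> its coefficients inherit the sparsity of those of \<open>w\<close>.\<close>
    define q where "q z = exp (A z) * p z" for z
    have qc: "continuous_on (sphere 0 1) q" unfolding q_def by (intro continuous_intros contA pc)
    have q_neg: "circ_coeff q n = 0" if "n < 0" for n
    proof -
      have "(\<lambda>i. a i * circ_coeff p (n - int i)) sums circ_coeff q n"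
        unfolding q_def by (intro circ_coeff_series_mult sa pc a) (use \<rho> in auto)
      moreover have "circ_coeff p (n - int i) = 0" for i
        unfolding p_def by (rule circ_coeff_sum_power(2)) (use that in auto)
      ultimately show ?thesis using sums_unique2[OF sums_zero] by auto
    qed
    have q_bound: "cmod (circ_coeff q (int n)) \<le> B * K * D / \<rho> ^ (l - n)" if n: "n \<le> l" for n
    proof -
      have "circ_coeff (\<lambda>z. cnj (exp (- A z)) * w z) (int n) = circ_coeff q (int n)"
      proof (rule circ_coeff_cong)
        fix z :: complex assume z: "z \<in> sphere 0 1"
        have "complex_of_real (f z) = exp (A z + cnj (A z))"
          unfolding fA[OF z] exp_of_real[symmetric] by (rule arg_cong[where f = exp]) (simp add: complex_eq_iff)
        then show "cnj (exp (- A z)) * w z = q z"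
          by (simp add: w_def q_def exp_cnj exp_add exp_minus)
      qed
      moreover have "(\<lambda>i. cnj (b i) * circ_coeff w (int n + int i)) sums
          circ_coeff (\<lambda>z. cnj (exp (- A z)) * w z) (int n)"
        by (intro circ_coeff_cnj_series_mult sb wc b) (use \<rho> in auto)
      ultimately have "(\<lambda>i. cnj (b i) * circ_coeff w (int n + int i)) sums circ_coeff q (int n)"
        by simp
      then have "cmod (circ_coeff q (int n)) \<le> B * K / (1 - 1 / \<rho>) / \<rho> ^ (l - n)"
      proof (rule norm_sums_geometric_tail[OF _ \<rho>(1)])
        fix i
        have "cmod (b i) * cmod (circ_coeff w (int n + int i)) \<le> B / \<rho> ^ i * K"
          using B0 \<rho> by (intro mult_mono B w_bound) auto
        then show "cmod (cnj (b i) * circ_coeff w (int n + int i)) \<le> B * K / \<rho> ^ i"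
          by (simp add: norm_mult ac_simps)
      next
        \<comment> \<open>Here \<open>n + i < l \<le> N\<close>, so the system forces this
          coefficient of \<open>w\<close> to be 0. The series starts at \<open>i = l - n\<close>,
          and beyond that only the bound \<open>K\<close> is used.\<close>
        fix i assume "i < l - n"
        then show "cnj (b i) * circ_coeff w (int n + int i) = 0"
          using w_eq[of "n + i"] l by simp
      qed
      then show ?thesis by (simp add: D_def)
    qed
    have p_eq: "circ_coeff p (int k) = v k"
      unfolding p_def using circ_coeff_sum_power(1)[of v N k] k l by simp
    have "(\<lambda>i. b i * circ_coeff q (int k - int i)) sums circ_coeff (\<lambda>z. exp (- A z) * q z) (int k)"
      by (intro circ_coeff_series_mult sb qc b) (use \<rho> in auto)
    also have "circ_coeff (\<lambda>z. exp (- A z) * q z) (int k) = circ_coeff p (int k)"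
      by (intro circ_coeff_cong) (simp add: q_def exp_minus)
    finally have "(\<lambda>i. b i * circ_coeff q (int k - int i)) sums v k" unfolding p_eq .
    \<comment> \<open>No leading zeros are needed now: each \<open>q\<close> coefficient met here
      has index \<open>k - i \<le> k\<close>, so it is either zero or already as small as the bound
      at \<open>k\<close>.\<close>
    then have "cmod (v k) \<le> (B * (B * K * D / \<rho> ^ (l - k))) / (1 - 1 / \<rho>) / \<rho> ^ 0"
    proof (rule norm_sums_geometric_tail[OF _ \<rho>(1)])
      have K0: "0 \<le> B * K * D / \<rho> ^ (l - k)"
        using q_bound[OF k] norm_ge_zero order_trans by blast
      fix i
      have "cmod (circ_coeff q (int k - int i)) \<le> B * K * D / \<rho> ^ (l - k)"
      proof (cases "i \<le> k")
        case True
        have "cmod (circ_coeff q (int (k - i))) \<le> B * K * D / \<rho> ^ (l - (k - i))"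
          using k by (intro q_bound) auto
        also have "\<dots> \<le> B * K * D / \<rho> ^ (l - k)"
        proof -
          have "0 < \<rho> ^ (l - k)" using \<rho>0 by simp
          then have "0 \<le> B * K * D" using K0 by (simp add: zero_le_divide_iff)
          moreover have "\<rho> ^ (l - k) \<le> \<rho> ^ (l - (k - i))" using \<rho> by (intro power_increasing) auto
          ultimately show ?thesis using \<rho> by (intro divide_left_mono) auto
        qed
        finally show ?thesis using True by (simp add: of_nat_diff)
      next
        case False
        then show ?thesis using q_neg[of "int k - int i"] K0 by simp
      qed
      then have "cmod (b i) * cmod (circ_coeff q (int k - int i)) \<le> B / \<rho> ^ i * (B * K * D / \<rho> ^ (l - k))"
        using B0 \<rho> by (intro mult_mono B) auto
      then show "cmod (b i * circ_coeff q (int k - int i)) \<le> B * (B * K * D / \<rho> ^ (l - k)) / \<rho> ^ i"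
        by (simp add: norm_mult ac_simps)
    qed simp
    then show ?thesis by (simp add: D_def ac_simps)
  qed
  then show ?thesis by blast
qed

section \<open>From circle coefficients to the matrix and its inverse\<close>

lemma fourier_coeff_eq_circ_coeff:
  assumes f: "continuous_on (sphere 0 1) f"
  shows "fourier_coeff f j = circ_coeff (\<lambda>z. of_real (f z)) j"
proof -
  have "continuous_on {0..2 * pi} (\<lambda>t. complex_of_real (f (cis t)) * cis (- (of_int j * t)))"
    by (intro continuous_intros continuous_on_circ_param f)
  then have "set_integrable lborel {0..2 * pi} (\<lambda>t. complex_of_real (f (cis t)) * cis (- (of_int j * t)))"
    by (intro borel_integrable_compact[unfolded set_integrable_def[symmetric]]) auto
  from set_borel_integral_eq_integral(2)[OF this] show ?thesis
    unfolding fourier_coeff_def circ_coeff_def circ_mean_def by (simp add: cis_power_int)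
qed

lemma fourier_coeff_uminus: "continuous_on (sphere 0 1) f \<Longrightarrow> fourier_coeff f (- j) = cnj (fourier_coeff f j)"
  using circ_coeff_cnj[of "\<lambda>z. of_real (f z)" "- j"] by (simp add: fourier_coeff_eq_circ_coeff)

lemma toeplitz_carrier: "toeplitz N f \<in> carrier_mat (N + 1) (N + 1)"
  by (simp add: toeplitz_def)

text \<open>A kernel vector is the coefficient vector of a polynomial with zero energy. Since
  \<open>f > 0\<close>, this polynomial vanishes on the circle, and so do its coefficients.\<close>

lemma det_toeplitz_nonzero:
  fixes f :: "complex \<Rightarrow> real"
  assumes f: "continuous_on (sphere 0 1) f" and pos: "\<And>z. z \<in> sphere 0 1 \<Longrightarrow> f z > 0"
  shows "Determinant.det (toeplitz N f) \<noteq> 0"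
proof
  assume "Determinant.det (toeplitz N f) = 0"
  then obtain x where x: "x \<in> carrier_vec (N + 1)" "x \<noteq> 0\<^sub>v (N + 1)"
    and Tx: "toeplitz N f *\<^sub>v x = 0\<^sub>v (N + 1)"
    using det_0_iff_vec_prod_zero[OF toeplitz_carrier] by blast
  define v where "v j = vec_index x j" for j
  define p where "p z = (\<Sum>j\<le>N. v j * z ^ j)" for z
  have pc: "continuous_on (sphere 0 1) p" unfolding p_def by (intro continuous_intros)
  have "(\<Sum>j\<le>N. v j * circ_coeff (\<lambda>z. of_real (f z)) (int n - int j)) = 0" if "n \<le> N" for n
  proof -
    have "vec_index (toeplitz N f *\<^sub>v x) n = 0" unfolding Tx using that by simp
    then show ?thesis
      using that x(1) unfolding toeplitz_def v_def
      by (simp add: scalar_prod_def fourier_coeff_eq_circ_coeff[OF f] atLeast0LessThan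
          lessThan_Suc_atMost mult.commute)
  qed
  then have "circ_mean (\<lambda>z. of_real (f z * cmod (p z) ^ 2)) = 0"
    unfolding p_def toeplitz_quadratic_form[OF f] by simp
  then have "integral {0..2 * pi} (\<lambda>t. f (cis t) * cmod (p (cis t)) ^ 2) = 0"
    by (subst (asm) circ_mean_of_real) (auto intro!: continuous_intros f pc)
  moreover have "0 \<le> f (cis t) * cmod (p (cis t)) ^ 2" for t
    using pos[of "cis t"] by simp
  ultimately have "\<forall>t\<in>{0..2 * pi}. f (cis t) * cmod (p (cis t)) ^ 2 = 0"
    by (subst (asm) integral_eq_0_iff) (auto intro!: continuous_intros continuous_on_circ_param f pc)
  moreover have "f (cis t) \<noteq> 0" for t using pos[of "cis t"] by simp
  ultimately have "p z = 0" if "z \<in> sphere 0 1" for z using sphere_cisE[OF that] by fastforce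
  then have "circ_coeff p n = circ_coeff (\<lambda>z. 0) n" for n by (intro circ_coeff_cong)
  then have "v n = 0" if "n \<le> N" for n
    using circ_coeff_sum_power(1)[of v N n] that unfolding p_def
    by (simp add: circ_coeff_def circ_mean_const)
  then have "x = 0\<^sub>v (N + 1)" using x(1) by (intro eq_vecI) (auto simp: v_def)
  with x(2) show False by contradiction
qed

lemma toeplitz_inverse:
  fixes f :: "complex \<Rightarrow> real"
  assumes f: "continuous_on (sphere 0 1) f" and pos: "\<And>z. z \<in> sphere 0 1 \<Longrightarrow> f z > 0"
  obtains X where "mat_inverse (toeplitz N f) = Some X"
    and "\<And>n l. n \<le> N \<Longrightarrow> l \<le> N \<Longrightarrow>
      (\<Sum>j\<le>N. X $$ (j, l) * fourier_coeff f (int n - int j)) = (if n = l then 1 else 0)"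
    and "\<And>n k. n \<le> N \<Longrightarrow> k \<le> N \<Longrightarrow>
      (\<Sum>j\<le>N. cnj (X $$ (k, j)) * fourier_coeff f (int n - int j)) = (if n = k then 1 else 0)"
proof -
  \<comment> \<open>Being a unit of the matrix ring excludes \<open>None\<close>, so
    \<open>the\<close> in \<open>toeplitz_inv_entry\<close> yields a genuine inverse.\<close>
  have "toeplitz N f \<in> Units (ring_mat TYPE(complex) (N + 1) ())"
    by (rule det_non_zero_imp_unit[OF toeplitz_carrier det_toeplitz_nonzero[OF f pos]])
  then have "mat_inverse (toeplitz N f) \<noteq> None"
    using mat_inverse(1)[OF toeplitz_carrier[of N f], where b = "()"] by argo
  then obtain X where X: "mat_inverse (toeplitz N f) = Some X" by blast
  have TX: "toeplitz N f * X = 1\<^sub>m (N + 1)" and XT: "X * toeplitz N f = 1\<^sub>m (N + 1)"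
    and XC: "X \<in> carrier_mat (N + 1) (N + 1)"
    using mat_inverse(2)[OF toeplitz_carrier X] by auto
  have col: "(\<Sum>j\<le>N. X $$ (j, l) * fourier_coeff f (int n - int j)) = (if n = l then 1 else 0)"
    if "n \<le> N" "l \<le> N" for n l
  proof -
    have "(toeplitz N f * X) $$ (n, l) = (if n = l then 1 else 0)" unfolding TX using that by simp
    then show ?thesis
      using that XC unfolding toeplitz_def
      by (simp add: scalar_prod_def atLeast0LessThan lessThan_Suc_atMost mult.commute)
  qed
  have row: "(\<Sum>j\<le>N. cnj (X $$ (k, j)) * fourier_coeff f (int n - int j)) = (if n = k then 1 else 0)"
    if "n \<le> N" "k \<le> N" for n k
  proof -
    have "(X * toeplitz N f) $$ (k, n) = (if n = k then 1 else 0)" unfolding XT using that by simp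
    then have "(\<Sum>j\<le>N. X $$ (k, j) * fourier_coeff f (int j - int n)) = (if n = k then 1 else 0)"
      using that XC unfolding toeplitz_def
      by (simp add: scalar_prod_def atLeast0LessThan lessThan_Suc_atMost)
    \<comment> \<open>The Hermitian symmetry enters here: conjugation reverses the index difference,
      so a conjugated row solves the same system as a column.\<close>
    moreover have "cnj (X $$ (k, j)) * fourier_coeff f (int n - int j) =
        cnj (X $$ (k, j) * fourier_coeff f (int j - int n))" for j
      using fourier_coeff_uminus[OF f, of "int j - int n"] by simp
    ultimately show ?thesis by (simp only: flip: cnj_sum) simp
  qed
  show ?thesis by (rule that[OF X col row])
qed

theorem mainTheorem3:
  fixes f :: "complex \<Rightarrow> real" and \<rho>1 \<rho>2 :: real and k l :: "nat \<Rightarrow> nat"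
  assumes "continuous_on (sphere 0 1) f"
    and "regular_function f"
    and "\<rho>1 < 1" and "1 < \<rho>2"
    and "extends_to_annulus f \<rho>1 \<rho>2"
    and "\<And>N. k N \<in> {1..N + 1}" and "\<And>N. l N \<in> {1..N + 1}"
    and "filterlim (\<lambda>N. \<bar>int (k N) - int (l N)\<bar>) at_top sequentially"
  shows "\<forall>\<rho>\<in>{1<..<\<rho>2}.
    (\<lambda>N. toeplitz_inv_entry N f (k N) (l N))
      \<in> O(\<lambda>N. of_real ((1 / \<rho>) ^ nat \<bar>int (l N) - int (k N)\<bar>))"
proof
  fix \<rho> assume "\<rho> \<in> {1<..<\<rho>2}"
  then have \<rho>: "1 < \<rho>" "\<rho> < \<rho>2" by auto
  note f = assms(1)
  have pos: "f z > 0" if "z \<in> sphere 0 1" for z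
    using assms(2) that unfolding regular_function_def by blast
  \<comment> \<open>An intermediate radius: the exponentials of \<open>A\<close> are holomorphic on
    the disc of radius \<open>R\<close>, and Cauchy's inequality is then applied on the smaller
    radius \<open>\<rho>\<close>.\<close>
  obtain R where R: "\<rho> < R" "R < \<rho>2" using dense[OF \<rho>(2)] by blast
  have "1 < R" using \<rho> R by simp
  then obtain A where "A holomorphic_on ball 0 R" "\<And>z. z \<in> sphere 0 1 \<Longrightarrow> f z = exp (2 * Re (A z))"
    using positive_annulus_factor[OF assms(3,4,5) pos f _ R(2)] by blast
  from toeplitz_solution_decay[OF f pos this \<rho>(1) R(1)] obtain C where
    C: "\<And>N l v k. l \<le> N \<Longrightarrow> k \<le> l \<Longrightarrow>
      (\<And>n. n \<le> N \<Longrightarrow> (\<Sum>j\<le>N. v j * fourier_coeff f (int n - int j)) = (if n = l then 1 else 0)) \<Longrightarrow>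
      cmod (v k) \<le> C / \<rho> ^ (l - k)"
    unfolding fourier_coeff_eq_circ_coeff[OF f] by blast
  have "cmod (toeplitz_inv_entry N f (k N) (l N)) \<le> C * (1 / \<rho>) ^ nat \<bar>int (l N) - int (k N)\<bar>" for N
  proof -
    \<comment> \<open>Entries are counted from 1 in the statement and from 0 in the matrix; the
      shift leaves the index difference unchanged.\<close>
    define k' l' where "k' = k N - 1" and "l' = l N - 1"
    have kl: "k' \<le> N" "l' \<le> N" and diff: "int (l N) - int (k N) = int l' - int k'"
      using assms(6,7)[of N] by (auto simp: k'_def l'_def)
    obtain X where X: "mat_inverse (toeplitz N f) = Some X"
      and col: "\<And>n l. n \<le> N \<Longrightarrow> l \<le> N \<Longrightarrow>
        (\<Sum>j\<le>N. X $$ (j, l) * fourier_coeff f (int n - int j)) = (if n = l then 1 else 0)"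
      and row: "\<And>n k. n \<le> N \<Longrightarrow> k \<le> N \<Longrightarrow>
        (\<Sum>j\<le>N. cnj (X $$ (k, j)) * fourier_coeff f (int n - int j)) = (if n = k then 1 else 0)"
      using toeplitz_inverse[OF f pos] by blast
    have "cmod (X $$ (k', l')) \<le> C * (1 / \<rho>) ^ nat \<bar>int l' - int k'\<bar>"
    proof (cases "k' \<le> l'")
      case True
      with C[OF kl(2) True, of "\<lambda>j. X $$ (j, l')"] col kl show ?thesis
        by (simp add: power_divide nat_diff_distrib flip: of_nat_diff)
    next
      case False
      then have "l' \<le> k'" by simp
      \<comment> \<open>Below the diagonal the conjugated row \<open>k'\<close> is the solution,
        with right-hand side supported at \<open>k'\<close>, and \<open>l'\<close> is the smaller
        index.\<close>
      with C[OF kl(1) this, of "\<lambda>j. cnj (X $$ (k', j))"] row kl show ?thesis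
        by (simp add: power_divide abs_minus_commute[of "int l'"] flip: of_nat_diff)
    qed
    then show ?thesis unfolding toeplitz_inv_entry_def X diff by (simp add: k'_def l'_def)
  qed
  then have "cmod (toeplitz_inv_entry N f (k N) (l N)) \<le>
      C * norm (complex_of_real ((1 / \<rho>) ^ nat \<bar>int (l N) - int (k N)\<bar>))" for N
    using \<rho> by (simp add: norm_power norm_divide)
  then show "(\<lambda>N. toeplitz_inv_entry N f (k N) (l N))
      \<in> O(\<lambda>N. of_real ((1 / \<rho>) ^ nat \<bar>int (l N) - int (k N)\<bar>))"
    by (intro bigoI[of _ C] always_eventually allI)
qed

end
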